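(* Let $b,c$ be positive integers and let $(a_1,a_2)\in\Phi^{im}_+$. Write the quantum greedy element $X[a_1,a_2]\in\mathcal{A}_v(b,c)$ as $X[a_1,a_2]=\sum_{p,q\ge0}e(p,q)X_1^{(bp-a_1,\,cq-a_2)}$. Then the family of pointed coefficients $(e(p,q))_{p,q\in\mathbb{Z}_{\ge0}}$ is the unique family of elements of $\mathbb{Z}[v^{\pm1}]$ with $e(0,0)=1$ satisfying the following two axioms: (Support) $e(p,q)=0$ for all $(p,q)\notin R_{\text{greedy}}$; (Divisibility) with $t$ a formal variable commuting with $v$, for all integers $p,q\ge0$, in $\mathbb{Z}[v^{\pm1}][t]$: - $\prod_{j=1}^{a_2-cq}\big(1+v^{b(a_2-cq+1-2j)}t\big)$ divides $\sum_{i\ge0}e(i,q)t^i$; - $\prod_{j=1}^{a_1-bp}\big(1+v^{c(a_1-bp+1-2j)}t\big)$ divides $\sum_{i\ge0}e(p,i)t^i$; where a product $\prod_{j=1}^{n}$ with $n\le0$ is equal to $1$.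
   Context: Let $\mathcal{T}=\mathbb{Z}[v^{\pm1}]\langle X_1^{\pm1},X_2^{\pm1}: X_2X_1=v^2X_1X_2\rangle$ be the quantum torus and $\mathcal{F}$ its skew-field of fractions. The quantum cluster algebra $\mathcal{A}_v(b,c)$ is the $\mathbb{Z}[v^{\pm1}]$-subalgebra of $\mathcal{F}$ generated by the quantum cluster variables $\{X_m\}_{m\in\mathbb{Z}}$, defined recursively from $X_1,X_2$ by $X_{m+1}X_{m-1}=v^bX_m^b+1$ if $m$ is odd and $X_{m+1}X_{m-1}=v^cX_m^c+1$ if $m$ is even. It is known that $\mathcal{A}_v(b,c)\subset\mathcal{T}$. For $(a_1,a_2)\in\mathbb{Z}^2$ put $X_1^{(a_1,a_2)}=v^{a_1a_2}X_1^{a_1}X_2^{a_2}\in\mathcal{T}$. An element $X\in\mathcal{A}_v(b,c)$ is pointed at $(a_1,a_2)\in\mathbb{Z}^2$ if it has the form $X=\sum_{p,q\ge0}e(p,q)X_1^{(bp-a_1,\,cq-a_2)}$ (a finite sum) with $e(0,0)=1$ and $e(p,q)\in\mathbb{Z}[v^{\pm1}]$ for all $p,q$; the $e(p,q)$ are its pointed coefficients. $[a]_+=\max(a,0)$. For an invertible formal variable $w$, $n\in\mathbb{Z}$ and $k\in\mathbb{Z}_{\ge0}$: $[n]_w=\frac{w^n-w^{-n}}{w-w^{-1}}$ and ${n\brack k}_w=\frac{[n]_w[n-1]_w\cdots[n-k+1]_w}{[k]_w[k-1]_w\cdots[1]_w}$. Quantum greedy element: for each $(a_1,a_2)\in\mathbb{Z}^2$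 there is a unique element $X[a_1,a_2]$ of $\mathcal{A}_v(b,c)$ pointed at $(a_1,a_2)$ whose coefficients satisfy, for $(p,q)\in\mathbb{Z}_{\ge0}^2\setminus\{(0,0)\}$, $$e(p,q)=\sum_{k=1}^p(-1)^{k-1}e(p-k,q){[a_2-cq]_++k-1\brack k}_{v^b}\quad\text{if } ca_1q\le ba_2p,$$ $$e(p,q)=\sum_{\ell=1}^q(-1)^{\ell-1}e(p,q-\ell){[a_1-bp]_++\ell-1\brack \ell}_{v^c}\quad\text{if } ca_1q\ge ba_2p.$$ The set of positive imaginary roots is $\Phi^{im}_+=\{(a_1,a_2)\in\mathbb{Z}_{>0}^2: ca_1^2-bca_1a_2+ba_2^2\le0\}$. For $(a_1,a_2)\in\Phi^{im}_+$, $$R_{\text{greedy}}=\Big\{(p,q)\in\mathbb{R}_{\ge0}^2 : q+\Big(b-\frac{ba_2}{ca_1}\Big)p<a_1\ \text{ or }\ p+\Big(c-\frac{ca_1}{ba_2}\Big)q<a_2\Big\}\cup\{(0,a_1),(a_2,0)\}.$$ *)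

theory Defs
  imports Complex_Main
    "HOL-Library.Poly_Mapping"
    "HOL-Computational_Algebra.Polynomial"
    "HOL-Computational_Algebra.Fraction_Field"
begin

section \<open>Laurent polynomials in v and the quantum torus\<close>

text \<open>The ring Z[v, 1/v] is the group ring of the additive group of integers, with v^n
  the basis element at n.\<close>

type_synonym laurent = "int \<Rightarrow>\<^sub>0 int"

definition vpow :: "int \<Rightarrow> laurent" where
  "vpow n = Poly_Mapping.single n 1"

text \<open>\<open>QMon k i j\<close> stands for the monomial v^k X_1^i X_2^j.  These monomials form a
  (non-commutative) group, and from X_2 X_1 = v^2 X_1 X_2 one gets
  X_2^j X_1^i = v^(2ij) X_1^i X_2^j.  The quantum torus is free over Z on these monomials, i.e.
  it is the group ring of this group.  The group is written additively because convolution on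
  \<open>\<Rightarrow>\<^sub>0\<close> is.\<close>

datatype qmon = QMon (v_exp: int) (x1_exp: int) (x2_exp: int)

instantiation qmon :: group_add
begin

definition "0 = QMon 0 0 0"

fun plus_qmon :: "qmon \<Rightarrow> qmon \<Rightarrow> qmon" where
  "QMon k i j + QMon k' i' j' = QMon (k + k' + 2 * j * i') (i + i') (j + j')"

fun uminus_qmon :: "qmon \<Rightarrow> qmon" where
  "- QMon k i j = QMon (2 * i * j - k) (- i) (- j)"

definition minus_qmon :: "qmon \<Rightarrow> qmon \<Rightarrow> qmon" where
  "minus_qmon a b = a + (- b)"

instance
proof
  fix a b c :: qmon
  show "a + b + c = a + (b + c)"
    by (cases a; cases b; cases c) (simp add: algebra_simps)
  show "0 + a = a" "a + 0 = a" "- a + a = 0"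
    by (cases a; simp add: zero_qmon_def)+
  show "a + (- b) = a - b"
    by (simp add: minus_qmon_def)
qed

end

type_synonym qtorus = "qmon \<Rightarrow>\<^sub>0 int"

definition qtorus_scalar :: "laurent \<Rightarrow> qtorus" where
  "qtorus_scalar f = (\<Sum>k\<in>Poly_Mapping.keys f. Poly_Mapping.single (QMon k 0 0) (Poly_Mapping.lookup f k))"

definition X1_pow :: "int \<Rightarrow> qtorus" where
  "X1_pow n = Poly_Mapping.single (QMon 0 n 0) 1"

definition X2_pow :: "int \<Rightarrow> qtorus" where
  "X2_pow n = Poly_Mapping.single (QMon 0 0 n) 1"

definition X_monomial :: "int \<Rightarrow> int \<Rightarrow> qtorus" where
  "X_monomial a1 a2 = qtorus_scalar (vpow (a1 * a2)) * X1_pow a1 * X2_pow a2"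

lemma qtorus_scalar_single [simp]:
  "qtorus_scalar (Poly_Mapping.single k a) = Poly_Mapping.single (QMon k 0 0) a"
  by (simp add: qtorus_scalar_def)

lemma qtorus_scalar_superset:
  assumes "finite A" "Poly_Mapping.keys f \<subseteq> A"
  shows "qtorus_scalar f = (\<Sum>k\<in>A. Poly_Mapping.single (QMon k 0 0) (Poly_Mapping.lookup f k))"
  unfolding qtorus_scalar_def
  by (rule sum.mono_neutral_left[OF assms]) (auto simp: in_keys_iff)

lemma qtorus_scalar_add: "qtorus_scalar (f + g) = qtorus_scalar f + qtorus_scalar g"
proof -
  let ?A = "Poly_Mapping.keys f \<union> Poly_Mapping.keys g"
  have "Poly_Mapping.keys (f + g) \<subseteq> ?A"
    by (rule Poly_Mapping.keys_add)
  then show ?thesis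
    by (simp add: qtorus_scalar_superset[of ?A] lookup_add single_add sum.distrib)
qed

lemma qtorus_scalar_one: "qtorus_scalar 1 = 1"
  by (metis qtorus_scalar_single single_one zero_qmon_def)

lemma qtorus_scalar_mult: "qtorus_scalar (f * g) = qtorus_scalar f * qtorus_scalar g"
proof -
  have update_conv_add: "Poly_Mapping.update k a h = h + Poly_Mapping.single k a"
    if "k \<notin> Poly_Mapping.keys h" for k and a :: int and h :: laurent
    using that by (intro poly_mapping_eqI) (auto simp: lookup_update lookup_add lookup_single in_keys_iff)
  have zero: "qtorus_scalar 0 = 0"
    by (simp add: qtorus_scalar_def)
  have sg: "qtorus_scalar (Poly_Mapping.single k a * g) =
      Poly_Mapping.single (QMon k 0 0) a * qtorus_scalar g" for k a
    by (induction g rule: update_induct)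
      (simp_all add: zero update_conv_add mult_single qtorus_scalar_add algebra_simps)
  show ?thesis
    by (induction f rule: update_induct)
      (simp_all add: zero sg update_conv_add qtorus_scalar_add distrib_right)
qed

lemma X2_X1: "X2_pow 1 * X1_pow 1 = qtorus_scalar (vpow 2) * X1_pow 1 * X2_pow 1"
  by (simp add: X1_pow_def X2_pow_def vpow_def mult_single)

lemma X1_pow_add: "X1_pow (m + n) = X1_pow m * X1_pow n" "X1_pow 0 = 1"
  by (simp_all add: X1_pow_def mult_single flip: zero_qmon_def)

lemma X2_pow_add: "X2_pow (m + n) = X2_pow m * X2_pow n" "X2_pow 0 = 1"
  by (simp_all add: X2_pow_def mult_single flip: zero_qmon_def)

lemma X_monomial_single: "X_monomial a1 a2 = Poly_Mapping.single (QMon (a1 * a2) a1 a2) 1"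
  by (simp add: X_monomial_def X1_pow_def X2_pow_def vpow_def mult_single)


section \<open>The skew-field of fractions and the quantum cluster algebra\<close>

text \<open>The skew-field of fractions of the quantum torus (an Ore domain), given as an arbitrary
  division ring with an embedding of the quantum torus in which every element is a right
  fraction; it is unique up to unique isomorphism.\<close>

locale skew_field_of_fractions =
  fixes \<iota> :: "qtorus \<Rightarrow> 'f::division_ring"
  assumes add: "\<iota> (x + y) = \<iota> x + \<iota> y"
    and mult: "\<iota> (x * y) = \<iota> x * \<iota> y"
    and one: "\<iota> 1 = 1"
    and inj: "inj \<iota>"
    and fractions: "\<exists>x y. y \<noteq> 0 \<and> z = \<iota> x * inverse (\<iota> y)"

text \<open>The right-hand side of the exchange relation X_(m+1) X_(m-1) = v^d X_m^d + 1, with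
  d = b for odd m and d = c for even m, as a function of z = X_m.\<close>

definition exchange_rhs ::
    "(qtorus \<Rightarrow> 'f::division_ring) \<Rightarrow> nat \<Rightarrow> nat \<Rightarrow> int \<Rightarrow> 'f \<Rightarrow> 'f" where
  "exchange_rhs \<iota> b c m z =
    (let d = (if odd m then b else c) in \<iota> (qtorus_scalar (vpow (int d))) * z ^ d + 1)"

text \<open>The exchange relation is solved for X_(m+1) when m \<open>\<ge>\<close> 2, and for X_(m-1) when m \<open>\<le>\<close> 1.\<close>

function cluster_var ::
    "(qtorus \<Rightarrow> 'f::division_ring) \<Rightarrow> nat \<Rightarrow> nat \<Rightarrow> int \<Rightarrow> 'f" where
  "cluster_var \<iota> b c m =
    (if m = 1 then \<iota> (X1_pow 1)
     else if m = 2 then \<iota> (X2_pow 1)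
     else if m > 2 then
       exchange_rhs \<iota> b c (m - 1) (cluster_var \<iota> b c (m - 1)) * inverse (cluster_var \<iota> b c (m - 2))
     else
       inverse (cluster_var \<iota> b c (m + 2)) * exchange_rhs \<iota> b c (m + 1) (cluster_var \<iota> b c (m + 1)))"
  by pat_completeness auto
termination
  by (relation "Wellfounded.measure (\<lambda>(\<iota>, b, c, m). nat \<bar>2 * m - 3\<bar>)") auto

declare cluster_var.simps [simp del]

lemma cluster_var_exchange:
  assumes "\<And>m. cluster_var \<iota> b c m \<noteq> 0"
  shows "cluster_var \<iota> b c (m + 1) * cluster_var \<iota> b c (m - 1)
    = exchange_rhs \<iota> b c m (cluster_var \<iota> b c m)"
proof (cases "m \<ge> 2")
  case True
  then show ?thesis
    using assms by (subst cluster_var.simps) (simp add: mult.assoc)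
next
  case False
  then show ?thesis
    using assms by (subst (2) cluster_var.simps) (simp add: add.commute flip: mult.assoc)
qed

inductive_set cluster_algebra ::
    "(qtorus \<Rightarrow> 'f::division_ring) \<Rightarrow> nat \<Rightarrow> nat \<Rightarrow> 'f set"
  for \<iota> :: "qtorus \<Rightarrow> 'f::division_ring" and b c :: nat where
  scalar: "\<iota> (qtorus_scalar f) \<in> cluster_algebra \<iota> b c"
| var: "cluster_var \<iota> b c m \<in> cluster_algebra \<iota> b c"
| add: "x \<in> cluster_algebra \<iota> b c \<Longrightarrow> y \<in> cluster_algebra \<iota> b c \<Longrightarrow> x + y \<in> cluster_algebra \<iota> b c"
| mult: "x \<in> cluster_algebra \<iota> b c \<Longrightarrow> y \<in> cluster_algebra \<iota> b c \<Longrightarrow> x * y \<in> cluster_algebra \<iota> b c"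


section \<open>Pointed and quantum greedy elements\<close>

definition has_expansion ::
    "(qtorus \<Rightarrow> 'f::division_ring) \<Rightarrow> nat \<Rightarrow> nat \<Rightarrow> int \<Rightarrow> int \<Rightarrow> 'f \<Rightarrow> (nat \<Rightarrow> nat \<Rightarrow> laurent) \<Rightarrow> bool" where
  "has_expansion \<iota> b c a1 a2 X e \<longleftrightarrow>
    finite {(p, q). e p q \<noteq> 0} \<and>
    X = \<iota> (\<Sum>(p, q)\<in>{(p, q). e p q \<noteq> 0}.
             qtorus_scalar (e p q) * X_monomial (int b * int p - a1) (int c * int q - a2))"

definition pointed_with ::
    "(qtorus \<Rightarrow> 'f::division_ring) \<Rightarrow> nat \<Rightarrow> nat \<Rightarrow> int \<Rightarrow> int \<Rightarrow> 'f \<Rightarrow> (nat \<Rightarrow> nat \<Rightarrow> laurent) \<Rightarrow> bool" where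
  "pointed_with \<iota> b c a1 a2 X e \<longleftrightarrow>
    X \<in> cluster_algebra \<iota> b c \<and> has_expansion \<iota> b c a1 a2 X e \<and> e 0 0 = 1"

definition qint :: "'k::field \<Rightarrow> int \<Rightarrow> 'k" where
  "qint w n = (w powi n - w powi (- n)) / (w - inverse w)"

definition qbinom :: "'k::field \<Rightarrow> int \<Rightarrow> nat \<Rightarrow> 'k" where
  "qbinom w n k = (\<Prod>i<k. qint w (n - int i)) / (\<Prod>i=1..k. qint w (int i))"

abbreviation to_frac :: "laurent \<Rightarrow> laurent fract" where
  "to_frac f \<equiv> Fract f 1"

definition pos_part :: "int \<Rightarrow> int" where
  "pos_part a = max a 0"

text \<open>The quantum binomials are quotients, so the recursion is stated in the field of
  fractions of Z[v, 1/v].\<close>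

definition greedy_recursion ::
    "nat \<Rightarrow> nat \<Rightarrow> int \<Rightarrow> int \<Rightarrow> (nat \<Rightarrow> nat \<Rightarrow> laurent) \<Rightarrow> bool" where
  "greedy_recursion b c a1 a2 e \<longleftrightarrow>
    (\<forall>p q :: nat. (p, q) \<noteq> (0, 0) \<longrightarrow>
      (int c * a1 * int q \<le> int b * a2 * int p \<longrightarrow>
        to_frac (e p q) =
          (\<Sum>k=1..p. (- 1) ^ (k - 1) * to_frac (e (p - k) q) *
             qbinom (to_frac (vpow (int b))) (pos_part (a2 - int c * int q) + int k - 1) k)) \<and>
      (int c * a1 * int q \<ge> int b * a2 * int p \<longrightarrow>
        to_frac (e p q) =
          (\<Sum>l=1..q. (- 1) ^ (l - 1) * to_frac (e p (q - l)) *
             qbinom (to_frac (vpow (int c))) (pos_part (a1 - int b * int p) + int l - 1) l)))"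

definition quantum_greedy ::
    "(qtorus \<Rightarrow> 'f::division_ring) \<Rightarrow> nat \<Rightarrow> nat \<Rightarrow> int \<Rightarrow> int \<Rightarrow> 'f \<Rightarrow> bool" where
  "quantum_greedy \<iota> b c a1 a2 X \<longleftrightarrow>
    (\<exists>e. pointed_with \<iota> b c a1 a2 X e \<and> greedy_recursion b c a1 a2 e)"


section \<open>Imaginary roots and the two axioms\<close>

definition pos_imaginary_roots :: "nat \<Rightarrow> nat \<Rightarrow> (int \<times> int) set" where
  "pos_imaginary_roots b c =
    {(a1, a2). a1 > 0 \<and> a2 > 0 \<and> int c * a1^2 - int b * int c * a1 * a2 + int b * a2^2 \<le> 0}"

definition R_greedy :: "nat \<Rightarrow> nat \<Rightarrow> int \<Rightarrow> int \<Rightarrow> (real \<times> real) set" where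
  "R_greedy b c a1 a2 =
    {(p, q). p \<ge> 0 \<and> q \<ge> 0 \<and>
      (q + (real b - real b * real_of_int a2 / (real c * real_of_int a1)) * p < real_of_int a1 \<or>
       p + (real c - real c * real_of_int a1 / (real b * real_of_int a2)) * q < real_of_int a2)}
    \<union> {(0, real_of_int a1), (real_of_int a2, 0)}"

definition support_axiom ::
    "nat \<Rightarrow> nat \<Rightarrow> int \<Rightarrow> int \<Rightarrow> (nat \<Rightarrow> nat \<Rightarrow> laurent) \<Rightarrow> bool" where
  "support_axiom b c a1 a2 e \<longleftrightarrow>
    (\<forall>p q :: nat. (real p, real q) \<notin> R_greedy b c a1 a2 \<longrightarrow> e p q = 0)"

text \<open>The product over j = 1, ..., n of 1 + v^(d (n + 1 - 2j)) t; the index set is empty for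
  n \<open>\<le>\<close> 0.\<close>

definition divisor_poly :: "nat \<Rightarrow> int \<Rightarrow> laurent poly" where
  "divisor_poly d n = (\<Prod>j\<in>{1..n}. [:1, vpow (int d * (n + 1 - 2 * j)):])"

text \<open>The formal sum of the f i t^i is a polynomial (i.e. f has finite support) and is
  divisible by D.\<close>

definition dvd_gen_poly :: "laurent poly \<Rightarrow> (nat \<Rightarrow> laurent) \<Rightarrow> bool" where
  "dvd_gen_poly D f \<longleftrightarrow> (\<exists>P. (\<forall>i. coeff P i = f i) \<and> D dvd P)"

definition divisibility_axiom ::
    "nat \<Rightarrow> nat \<Rightarrow> int \<Rightarrow> int \<Rightarrow> (nat \<Rightarrow> nat \<Rightarrow> laurent) \<Rightarrow> bool" where
  "divisibility_axiom b c a1 a2 e \<longleftrightarrow>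
    (\<forall>p q :: nat.
      dvd_gen_poly (divisor_poly b (a2 - int c * int q)) (\<lambda>i. e i q) \<and>
      dvd_gen_poly (divisor_poly c (a1 - int b * int p)) (\<lambda>i. e p i))"

end

theory Submission
  imports Defs "HOL-Computational_Algebra.Polynomial_FPS"
begin

text \<open>Let \<open>P\<close> be the generating polynomial of a row \<open>q\<close> of coefficients, \<open>N = a2 - c q\<close>, and \<open>D\<close> the
  divisor attached to that row.  By the quantum binomial series, the coefficients of \<open>1 / D\<close> are
  the signed quantum binomials of the greedy recursion, so the recursion at \<open>(p, q)\<close> says exactly
  that the coefficient of \<open>t^p\<close> in the power series \<open>P / D\<close> vanishes.  Hence the greedy recursion
  means that \<open>P / D\<close> is a polynomial (divisibility) of degree below \<open>c a1 q / (b a2)\<close>, and as \<open>D\<close> has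
  degree \<open>max N 0\<close>, this amounts to the degree bound on \<open>P\<close> that the support condition prescribes.
  The same holds for columns.  So the two axioms are equivalent to the recursion, which determines
  all coefficients from \<open>e(0, 0)\<close>.\<close>

unbundle fps_syntax

section \<open>Quantum binomial series\<close>

definition sym_prod :: "'k::field \<Rightarrow> nat \<Rightarrow> 'k fps" where
  "sym_prod w n = (\<Prod>j=1..n. 1 + fps_const (w powi (int n + 1 - 2 * int j)) * fps_X)"

text \<open>The expansion of \<open>1 / sym_prod w n\<close> for natural \<open>n\<close>, as in the
  quantum binomial theorem with negative exponent; its coefficients are, up to sign, the weights of
  the greedy recursion.\<close>

definition sym_series :: "'k::field \<Rightarrow> int \<Rightarrow> 'k fps" where
  "sym_series w n = Abs_fps (\<lambda>k. (- 1) ^ k * qbinom w (n + int k - 1) k)"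

lemma qint_0 [simp]: "qint w 0 = 0"
  by (simp add: qint_def)

lemma qbinom_0 [simp]: "qbinom w n 0 = 1"
  by (simp add: qbinom_def)

lemma qint_add:
  fixes w :: "'k::field"
  assumes "w \<noteq> 0"
  shows "qint w (m + n) = w powi n * qint w m + w powi (- m) * qint w n"
proof -
  have 1: "w powi (m + n) = w powi m * w powi n"
    using assms by (simp add: power_int_add)
  have "w powi (- (m + n)) = w powi (- m) * w powi (- n)"
    using assms power_int_add[of w "-m" "-n"] by simp
  with 1 show ?thesis
    by (simp only: qint_def divide_inverse) (simp add: algebra_simps)
qed

text \<open>All three numerators share the factor \<open>A\<close>; what remains is
  \<open>qint_add\<close> for the splitting \<open>n + (k + 1)\<close>.\<close>

lemma qbinom_Suc_Pascal:
  fixes w :: "'k::field"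
  assumes w: "w \<noteq> 0" and nz: "\<And>i. i > 0 \<Longrightarrow> qint w (int i) \<noteq> 0"
  shows "qbinom w (n + int (Suc k)) (Suc k) =
    w powi int (Suc k) * qbinom w (n + int k) (Suc k) + w powi (- n) * qbinom w (n + int k) k"
proof -
  define A where "A = (\<Prod>i<k. qint w (n + int k - int i))"
  define B where "B = (\<Prod>i=1..k. qint w (int i))"
  have B: "B \<noteq> 0"
    using nz by (auto simp: B_def)
  have 1: "qbinom w (n + int (Suc k)) (Suc k) = qint w (n + int (Suc k)) * A / (B * qint w (int (Suc k)))"
    unfolding qbinom_def A_def B_def
    by (subst prod.lessThan_Suc_shift) (simp add: o_def algebra_simps)
  have 2: "qbinom w (n + int k) (Suc k) = A * qint w n / (B * qint w (int (Suc k)))"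
    unfolding qbinom_def A_def B_def by simp
  have 3: "qbinom w (n + int k) k = A / B"
    unfolding qbinom_def A_def B_def by simp
  show ?thesis
    unfolding 1 2 3 qint_add[OF w, of n] using B nz[of "Suc k"] by (simp add: field_simps)
qed

text \<open>Substituting \<open>w X\<close> for \<open>X\<close> raises every exponent by one, which
  turns the first \<open>n\<close> factors into those for \<open>Suc n\<close>; the new last factor
  has exponent \<open>- n\<close>.\<close>

lemma sym_prod_Suc:
  fixes w :: "'k::field"
  assumes w: "w \<noteq> 0"
  shows "sym_prod w (Suc n) =
    (sym_prod w n oo (fps_const w * fps_X)) * (1 + fps_const (w powi (- int n)) * fps_X)"
proof -
  have "(1 + fps_const (w powi (int n + 1 - 2 * int j)) * fps_X) oo (fps_const w * fps_X) =
      1 + fps_const (w powi (int (Suc n) + 1 - 2 * int j)) * fps_X" for j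
  proof -
    have "w powi (int (Suc n) + 1 - 2 * int j) = w powi (int n + 1 - 2 * int j) * w"
      using w by (subst power_int_add_1[symmetric]) (auto simp: algebra_simps)
    then show ?thesis
      by (simp add: fps_compose_add_distrib fps_compose_mult_distrib mult.assoc flip: fps_const_mult)
  qed
  then show ?thesis
    by (simp add: sym_prod_def fps_compose_prod_distrib algebra_simps)
qed

text \<open>The counterpart of \<open>sym_prod_Suc\<close> for the reciprocal series; on
  coefficients it is the Pascal rule.\<close>

lemma sym_series_Suc:
  fixes w :: "'k::field"
  assumes w: "w \<noteq> 0" and nz: "\<And>i. i > 0 \<Longrightarrow> qint w (int i) \<noteq> 0"
  shows "(1 + fps_const (w powi (- n)) * fps_X) * sym_series w (n + 1) =
    sym_series w n oo (fps_const w * fps_X)"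
proof (rule fps_ext)
  fix k
  show "((1 + fps_const (w powi (- n)) * fps_X) * sym_series w (n + 1)) $ k =
    (sym_series w n oo (fps_const w * fps_X)) $ k"
  proof (cases k)
    case 0
    then show ?thesis
      by (simp add: sym_series_def fps_compose_linear)
  next
    case (Suc k')
    have "qbinom w (n + int k) k =
        w powi int k * qbinom w (n + int k - 1) k + w powi (- n) * qbinom w (n + int k - 1) k'"
      using qbinom_Suc_Pascal[OF w nz, of n k'] by (simp add: Suc)
    moreover have "((1 + fps_const (w powi (- n)) * fps_X) * sym_series w (n + 1)) $ k =
        (- 1) ^ k * (qbinom w (n + int k) k - w powi (- n) * qbinom w (n + int k - 1) k')"
      by (simp add: Suc sym_series_def distrib_right mult.assoc algebra_simps)
    moreover have "(sym_series w n oo (fps_const w * fps_X)) $ k =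
        (- 1) ^ k * (w powi int k * qbinom w (n + int k - 1) k)"
      by (simp add: sym_series_def fps_compose_linear)
    ultimately show ?thesis
      by (metis add_diff_cancel_right')
  qed
qed

lemma sym_prod_mult_sym_series:
  fixes w :: "'k::field"
  assumes w: "w \<noteq> 0" and nz: "\<And>i. i > 0 \<Longrightarrow> qint w (int i) \<noteq> 0"
  shows "sym_prod w n * sym_series w (int n) = 1"
proof (induction n)
  case 0
  have "qbinom w (int k - 1) k = 0" if "k > 0" for k
  proof -
    have "(\<Prod>i<k. qint w (int k - 1 - int i)) = 0"
      \<comment> \<open>The factor with index \<open>k - 1\<close> is
        \<open>qint w 0 = 0\<close>.\<close>
      by (rule prod_zero) (use that in \<open>auto intro!: bexI[of _ "k - 1"] simp: of_nat_diff\<close>)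
    then show ?thesis
      by (simp add: qbinom_def)
  qed
  then show ?case
    by (intro fps_ext) (auto simp: sym_prod_def sym_series_def)
next
  case (Suc n)
  \<comment> \<open>The extra linear factor of the product is absorbed by the series, so both sides
    come from step \<open>n\<close> by the same substitution.\<close>
  have "sym_prod w (Suc n) * sym_series w (int (Suc n)) =
     (sym_prod w n * sym_series w (int n)) oo (fps_const w * fps_X)"
    using sym_series_Suc[OF w nz, of "int n"]
    by (simp add: sym_prod_Suc[OF w] fps_compose_mult_distrib mult.assoc add.commute)
  then show ?case
    by (simp add: Suc.IH)
qed


section \<open>The row quotient\<close>

lemma vpow_add: "vpow (m + n) = vpow m * vpow n"
  by (simp add: vpow_def mult_single)

lemma vpow_0 [simp]: "vpow 0 = 1"
  by (simp add: vpow_def)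

lemma vpow_nz [simp]: "vpow n \<noteq> 0"
  by (simp add: vpow_def)

lemma vpow_inject [simp]: "vpow m = vpow n \<longleftrightarrow> m = n"
  by (metis lookup_single_eq lookup_single_not_eq vpow_def zero_neq_one)

lemma to_frac_eq_iff: "to_frac f = to_frac g \<longleftrightarrow> f = g"
  by (simp add: eq_fract)

lemma to_frac_add: "to_frac (f + g) = to_frac f + to_frac g"
  by simp

lemma to_frac_sum: "to_frac (sum f A) = (\<Sum>x\<in>A. to_frac (f x))"
  by (induction A rule: infinite_finite_induct)
    (simp_all add: Zero_fract_def[symmetric] to_frac_add del: add_fract)

lemma to_frac_vpow_powi: "to_frac (vpow d) powi n = to_frac (vpow (d * n))"
proof -
  have pow: "to_frac (vpow d) ^ k = to_frac (vpow (d * int k))" for k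
    by (induction k) (simp_all add: One_fract_def algebra_simps vpow_add)
  have inv: "inverse (to_frac (vpow m)) = to_frac (vpow (- m))" for m
    by (simp add: eq_fract flip: vpow_add)
  show ?thesis
    by (cases n rule: int_cases2) (simp_all add: power_int_minus pow inv del: inverse_fract)
qed

text \<open>\<open>v\<close> has infinite order, so neither numerator nor denominator vanishes; this
  makes the quantum binomial series available at \<open>w = v^d\<close>.\<close>

lemma qint_to_frac_vpow_nz:
  assumes "d > 0" "i > 0"
  shows "qint (to_frac (vpow d)) (int i) \<noteq> 0"
proof -
  have inv: "inverse (to_frac (vpow d)) = to_frac (vpow (- d))"
    using to_frac_vpow_powi[of d "- 1"] by simp
  have "d * int i \<noteq> - (d * int i)"
    using assms by auto
  then show ?thesis
    using assms
    unfolding qint_def inv to_frac_vpow_powi divide_eq_0_iff right_minus_eq to_frac_eq_iff vpow_inject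
    by simp
qed

text \<open>The series \<open>P / D\<close>. Its coefficients stay in \<open>laurent\<close>, which
  is not a field: \<open>D\<close> has constant term 1, so the right inverse started at 1 exists
  over this ring.\<close>

definition row_quotient :: "nat \<Rightarrow> int \<Rightarrow> (nat \<Rightarrow> laurent) \<Rightarrow> laurent fps" where
  "row_quotient d n f = Abs_fps f * fps_right_inverse (fps_of_poly (divisor_poly d n)) 1"

text \<open>Moves identities to the fraction field, where the quantum binomials live.\<close>

definition frac_fps :: "laurent fps \<Rightarrow> laurent fract fps" where
  "frac_fps F = Abs_fps (\<lambda>n. to_frac (F $ n))"

lemma frac_fps_nth [simp]: "frac_fps F $ n = to_frac (F $ n)"
  by (simp add: frac_fps_def)

lemma frac_fps_mult: "frac_fps (F * G) = frac_fps F * frac_fps G"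
  by (rule fps_ext) (simp add: fps_mult_nth to_frac_sum)

lemma frac_fps_1: "frac_fps 1 = 1"
  by (rule fps_ext) (simp add: One_fract_def Zero_fract_def)

lemma frac_fps_prod: "frac_fps (prod F A) = (\<Prod>x\<in>A. frac_fps (F x))"
  by (induction A rule: infinite_finite_induct) (simp_all add: frac_fps_mult frac_fps_1)

section \<open>Divisor polynomials and their inverse power series\<close>

lemma coeff_0_divisor_poly [simp]: "coeff (divisor_poly d n) 0 = 1"
  by (simp add: divisor_poly_def poly_prod flip: poly_0_coeff_0)

lemma degree_divisor_poly [simp]: "degree (divisor_poly d n) = nat n"
  by (simp add: divisor_poly_def degree_prod_eq_sum_degree)

lemma divisor_poly_nz [simp]: "divisor_poly d n \<noteq> 0"
  by (metis coeff_0 coeff_0_divisor_poly zero_neq_one)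

lemma divisor_poly_mult_right_inverse:
  "fps_of_poly (divisor_poly d n) * fps_right_inverse (fps_of_poly (divisor_poly d n)) 1 = 1"
  by (rule fps_right_inverse) simp

lemma divisor_poly_mult_row_quotient:
  "fps_of_poly (divisor_poly d n) * row_quotient d n f = Abs_fps f"
  using divisor_poly_mult_right_inverse[of d n]
  by (simp add: row_quotient_def mult.left_commute)

lemma row_quotientI:
  assumes "fps_of_poly (divisor_poly d n) * Q = Abs_fps f"
  shows "row_quotient d n f = Q"
  using divisor_poly_mult_right_inverse[of d n]
  by (simp add: row_quotient_def mult.commute mult.left_commute flip: assms)

lemma frac_fps_divisor_poly:
  "frac_fps (fps_of_poly (divisor_poly d n)) = sym_prod (to_frac (vpow (int d))) (nat n)"
proof -
  have lin: "frac_fps (fps_of_poly [:1, vpow (int d * m):]) =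
      1 + fps_const (to_frac (vpow (int d)) powi m) * fps_X" for m
    by (rule fps_ext)
      (auto simp: to_frac_vpow_powi fps_X_def One_fract_def Zero_fract_def coeff_pCons split: nat.splits)
  have "frac_fps (fps_of_poly (divisor_poly d n)) =
      (\<Prod>j\<in>{1..n}. 1 + fps_const (to_frac (vpow (int d)) powi (n + 1 - 2 * j)) * fps_X)"
    by (simp add: divisor_poly_def fps_of_poly_prod frac_fps_prod lin)
  also have "\<dots> = sym_prod (to_frac (vpow (int d))) (nat n)"
    unfolding sym_prod_def
    by (rule prod.reindex_bij_witness[of _ int nat]) auto
  finally show ?thesis .
qed

lemma to_frac_row_quotient:
  assumes "d > 0"
  shows "to_frac (row_quotient d n f $ p) =
    (\<Sum>k\<le>p. (- 1) ^ k * to_frac (f (p - k)) * qbinom (to_frac (vpow (int d))) (pos_part n + int k - 1) k)"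
proof -
  let ?w = "to_frac (vpow (int d))"
  have w: "?w \<noteq> 0"
    by (simp add: Zero_fract_def eq_fract)
  have "frac_fps (fps_right_inverse (fps_of_poly (divisor_poly d n)) 1) = sym_series ?w (pos_part n)"
    (is "?I = ?S")
  proof -
    have I: "sym_prod ?w (nat n) * ?I = 1"
      using divisor_poly_mult_right_inverse[of d n]
      by (metis frac_fps_1 frac_fps_divisor_poly frac_fps_mult)
    \<comment> \<open>For \<open>n < 0\<close> the empty divisor product corresponds to the positive
      part in the recursion.\<close>
    have "int (nat n) = pos_part n"
      by (simp add: pos_part_def)
    then have S: "sym_prod ?w (nat n) * ?S = 1"
      using sym_prod_mult_sym_series[OF w, of "nat n"] qint_to_frac_vpow_nz[of "int d"] assms
      by simp
    \<comment> \<open>Two inverses of the same series agree.\<close>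
    have "?I = ?I * (sym_prod ?w (nat n) * ?S)"
      by (simp only: S mult_1_right)
    also have "\<dots> = sym_prod ?w (nat n) * ?I * ?S"
      by (simp only: mult_ac)
    finally show ?thesis
      by (simp only: I mult_1_left)
  qed
  then have "frac_fps (row_quotient d n f) = ?S * frac_fps (Abs_fps f)"
    by (simp add: row_quotient_def frac_fps_mult mult.commute)
  then have "to_frac (row_quotient d n f $ p) = (?S * frac_fps (Abs_fps f)) $ p"
    by (simp flip: frac_fps_nth)
  also have "\<dots> = (\<Sum>k\<le>p. (- 1) ^ k * to_frac (f (p - k)) *
      qbinom (to_frac (vpow (int d))) (pos_part n + int k - 1) k)"
    unfolding fps_mult_nth atLeast0AtMost
    by (rule sum.cong) (simp_all add: sym_series_def mult_ac)
  finally show ?thesis .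
qed

text \<open>The term \<open>k = 0\<close> of the convolution for \<open>P / D\<close> is
  \<open>f p\<close>; the other terms are the right-hand side of the recursion with opposite
  sign.\<close>

lemma row_recursion_iff:
  assumes "d > 0"
  shows "to_frac (f p) = (\<Sum>k=1..p. (- 1) ^ (k - 1) * to_frac (f (p - k)) *
      qbinom (to_frac (vpow (int d))) (pos_part n + int k - 1) k) \<longleftrightarrow> row_quotient d n f $ p = 0"
    (is "_ = ?S \<longleftrightarrow> _")
proof -
  have "to_frac (row_quotient d n f $ p) = to_frac (f p) +
     (\<Sum>k=1..p. (- 1) ^ k * to_frac (f (p - k)) *
        qbinom (to_frac (vpow (int d))) (pos_part n + int k - 1) k)"
    by (simp add: to_frac_row_quotient[OF assms] sum.atLeast1_atMost_eq sum.atMost_shift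
        lessThan_atLeast0 atLeastLessThanSuc_atLeastAtMost)
  also have "(\<Sum>k=1..p. (- 1) ^ k * to_frac (f (p - k)) *
        qbinom (to_frac (vpow (int d))) (pos_part n + int k - 1) k) = - ?S"
    unfolding sum_negf[symmetric]
    by (rule sum.cong) (auto simp: power_eq_if)
  finally have diff: "to_frac (row_quotient d n f $ p) = to_frac (f p) - ?S"
    by (simp only: add_uminus_conv_diff)
  have "to_frac (row_quotient d n f $ p) = 0 \<longleftrightarrow> row_quotient d n f $ p = 0"
    by (simp add: Zero_fract_def eq_fract)
  then show ?thesis
    unfolding diff right_minus_eq .
qed

text \<open>Compare coefficients in \<open>P = D Q\<close>: since \<open>D\<close> has degree
  \<open>nat n\<close>, only the last \<open>nat n + 1\<close> coefficients of \<open>Q\<close> up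
  to \<open>p\<close> contribute.\<close>

lemma row_nonzero_imp_quotient_nonzero:
  assumes "f p \<noteq> 0"
  obtains i where "i \<le> nat n" "i \<le> p" "row_quotient d n f $ (p - i) \<noteq> 0"
proof -
  have "f p = (\<Sum>i=0..p. coeff (divisor_poly d n) i * row_quotient d n f $ (p - i))"
    using arg_cong[OF divisor_poly_mult_row_quotient[of d n f], of "\<lambda>F. F $ p"]
    by (simp add: fps_mult_nth)
  then obtain i where "i \<le> p" "coeff (divisor_poly d n) i * row_quotient d n f $ (p - i) \<noteq> 0"
    using assms by (metis (no_types, lifting) atLeastAtMost_iff sum.neutral)
  then show ?thesis
    using that[of i] le_degree[of "divisor_poly d n" i] by auto
qed

text \<open>Divisibility makes the quotient a polynomial \<open>R\<close>. Leading coefficients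
  multiply to a nonzero one, so \<open>m = degree R\<close> works.\<close>

lemma quotient_nonzero_imp_row_nonzero:
  assumes "dvd_gen_poly (divisor_poly d n) f" "row_quotient d n f $ k \<noteq> 0"
  obtains m where "m \<ge> k" "f (m + nat n) \<noteq> 0"
proof -
  obtain P where P: "\<And>i. coeff P i = f i" "divisor_poly d n dvd P"
    using assms(1) unfolding dvd_gen_poly_def by blast
  obtain R where "P = divisor_poly d n * R"
    using P(2) by (rule dvdE)
  with P(1) have R: "\<And>i. coeff (divisor_poly d n * R) i = f i"
    by simp
  have "row_quotient d n f = fps_of_poly R"
    by (rule row_quotientI) (auto intro!: fps_ext simp: R simp flip: fps_of_poly_mult)
  then have "coeff R k \<noteq> 0"
    using assms(2) by simp
  moreover from this have "R \<noteq> 0"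
    by auto
  then have "f (degree R + nat n) \<noteq> 0"
    by (metis R add.commute coeff_mult_degree_sum degree_divisor_poly divisor_poly_nz
        leading_coeff_0_iff mult_eq_0_iff)
  ultimately show ?thesis
    using that le_degree by blast
qed

lemma dvd_gen_polyI:
  assumes "\<And>k. k \<ge> M \<Longrightarrow> row_quotient d n f $ k = 0"
  shows "dvd_gen_poly (divisor_poly d n) f"
proof -
  define R where "R = Abs_poly (\<lambda>k. row_quotient d n f $ k)"
  have "coeff R = (\<lambda>k. row_quotient d n f $ k)"
    unfolding R_def by (rule coeff_Abs_poly[of M]) (use assms in auto)
  then have "fps_of_poly R = row_quotient d n f"
    by (auto intro: fps_ext)
  then have "fps_of_poly (divisor_poly d n * R) = Abs_fps f"
    by (simp add: fps_of_poly_mult divisor_poly_mult_row_quotient)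
  then have "coeff (divisor_poly d n * R) i = f i" for i
    by (metis fps_nth_Abs_fps fps_of_poly_nth)
  then show ?thesis
    unfolding dvd_gen_poly_def by (intro exI[of _ "divisor_poly d n * R"]) simp
qed


section \<open>Recursion, support and divisibility\<close>

text \<open>The recursion along the first coordinate; the recursion along the second one is obtained
  by exchanging the roles of the two coordinates.\<close>

definition row_recursion :: "nat \<Rightarrow> nat \<Rightarrow> int \<Rightarrow> int \<Rightarrow> (nat \<Rightarrow> nat \<Rightarrow> laurent) \<Rightarrow> bool" where
  "row_recursion b c a1 a2 e \<longleftrightarrow>
    (\<forall>p q. (p, q) \<noteq> (0, 0) \<longrightarrow> int c * a1 * int q \<le> int b * a2 * int p \<longrightarrow>
      row_quotient b (a2 - int c * int q) (\<lambda>i. e i q) $ p = 0)"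

text \<open>The lattice points of \<open>R_greedy\<close>, with the denominators \<open>c a1\<close>
  and \<open>b a2\<close> cleared so that all later estimates are over the integers.\<close>

definition in_greedy_region :: "nat \<Rightarrow> nat \<Rightarrow> int \<Rightarrow> int \<Rightarrow> nat \<Rightarrow> nat \<Rightarrow> bool" where
  "in_greedy_region b c a1 a2 p q \<longleftrightarrow>
    int c * a1 * int q + int b * (int c * a1 - a2) * int p < int c * a1 * a1 \<or>
    int b * a2 * int p + int c * (int b * a2 - a1) * int q < int b * a2 * a2 \<or>
    p = 0 \<and> int q = a1 \<or> int p = a2 \<and> q = 0"

lemma in_greedy_region_swap: "in_greedy_region c b a2 a1 q p \<longleftrightarrow> in_greedy_region b c a1 a2 p q"
  by (auto simp: in_greedy_region_def)

lemma greedy_recursion_iff: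
  assumes "b > 0" "c > 0"
  shows "greedy_recursion b c a1 a2 e \<longleftrightarrow>
    row_recursion b c a1 a2 e \<and> row_recursion c b a2 a1 (\<lambda>q p. e p q)"
  unfolding greedy_recursion_def row_recursion_def
    row_recursion_iff[OF assms(1), of "\<lambda>i. e i _"] row_recursion_iff[OF assms(2)]
  by auto

lemma R_greedy_iff:
  assumes "b > 0" "c > 0" "a1 > 0" "a2 > 0"
  shows "(real p, real q) \<in> R_greedy b c a1 a2 \<longleftrightarrow> in_greedy_region b c a1 a2 p q"
proof -
  have clear: "real y + (real m - real m * real_of_int s / (real n * real_of_int r)) * real x < real_of_int r
    \<longleftrightarrow> int n * r * int y + int m * (int n * r - s) * int x < int n * r * r"
    if "n > 0" "r > 0" for m n x y :: nat and r s :: int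
  proof -
    have nr: "real n * real_of_int r > 0"
      using that by simp
    have "real y + (real m - real m * real_of_int s / (real n * real_of_int r)) * real x < real_of_int r
      \<longleftrightarrow> (real n * real_of_int r) * (real y + (real m - real m * real_of_int s / (real n * real_of_int r)) * real x)
         < (real n * real_of_int r) * real_of_int r"
      using nr by (metis mult_less_cancel_left_pos)
    also have "(real n * real_of_int r) * (real y + (real m - real m * real_of_int s / (real n * real_of_int r)) * real x)
      = real_of_int (int n * r * int y + int m * (int n * r - s) * int x)"
      using that by (simp add: field_simps)
    also have "(real n * real_of_int r) * real_of_int r = real_of_int (int n * r * r)"
      by simp
    finally show ?thesis
      unfolding of_int_less_iff .
  qed
  have "real q = real_of_int a1 \<longleftrightarrow> int q = a1" "real p = real_of_int a2 \<longleftrightarrow> int p = a2"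
    by linarith+
  then show ?thesis
    unfolding R_greedy_def in_greedy_region_def
    using clear[of c a1 q b a2 p] clear[of b a2 p c a1 q] assms by auto
qed

text \<open>Row recursion bounds the degree of \<open>P / D\<close>, hence that of \<open>P\<close>.
  The second alternative is where the row recursion is silent; the column recursion covers
  it.\<close>

lemma row_recursion_imp_region:
  assumes pos: "b > 0" "a1 > 0" "a2 > 0"
    and rec: "row_recursion b c a1 a2 e" and nz: "e p q \<noteq> 0"
  shows "in_greedy_region b c a1 a2 p q \<or> int b * a2 * int p < int c * a1 * int q"
proof -
  define n where "n = a2 - int c * int q"
  obtain i where i: "i \<le> nat n" "i \<le> p" "row_quotient b n (\<lambda>i. e i q) $ (p - i) \<noteq> 0"
    using row_nonzero_imp_quotient_nonzero[of "\<lambda>i. e i q" p n b] nz by metis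
  \<comment> \<open>The second disjunct is the origin, which the recursion exempts; it accounts for
    the corner \<open>(a2, 0)\<close>.\<close>
  have *: "int b * a2 * (int p - int i) < int c * a1 * int q \<or> q = 0 \<and> p = i"
    using rec i unfolding row_recursion_def n_def
    by (metis diff_is_0_eq le_antisym linorder_not_le of_nat_diff prod.inject)
  show ?thesis
  proof (cases "n > 0")
    case False
    have "q \<noteq> 0"
      using False pos by (intro notI) (simp add: n_def)
    then show ?thesis
      using * i False by auto
  next
    case True
    then have i': "int i \<le> n"
      using i by linarith
    from * show ?thesis
    proof
      assume "q = 0 \<and> p = i"
      then have "q = 0" "int p = a2 \<or> int p < a2"
        using i' by (auto simp: n_def)
      then show ?thesis
        using pos by (auto simp: in_greedy_region_def)
    next
      assume lt: "int b * a2 * (int p - int i) < int c * a1 * int q"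
      have "int b * a2 * int i \<le> int b * a2 * n"
        using i' pos by (intro mult_left_mono) auto
      with lt have "int b * a2 * int p + int c * (int b * a2 - a1) * int q < int b * a2 * a2"
        by (simp add: n_def algebra_simps)
      then show ?thesis
        by (simp add: in_greedy_region_def)
    qed
  qed
qed

lemma row_recursion_imp_divisible:
  assumes "b > 0" "a1 > 0" "a2 > 0" "row_recursion b c a1 a2 e"
  shows "dvd_gen_poly (divisor_poly b (a2 - int c * int q)) (\<lambda>i. e i q)"
proof (rule dvd_gen_polyI)
  \<comment> \<open>As \<open>b a2\<close> is at least 1, every such \<open>k\<close> is in the
    range of the recursion; the added 1 avoids the origin when \<open>q = 0\<close>.\<close>
  fix k assume k: "k \<ge> nat (int c * a1 * int q) + 1"
  have "1 * int k \<le> int b * a2 * int k"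
    using assms by (intro mult_right_mono) (auto simp: int_one_le_iff_zero_less)
  then have "int c * a1 * int q \<le> int b * a2 * int k"
    using k by linarith
  then show "row_quotient b (a2 - int c * int q) (\<lambda>i. e i q) $ k = 0"
    using assms(4) k by (auto simp: row_recursion_def)
qed

text \<open>A nonzero quotient coefficient in the range of the recursion would, by divisibility,
  give a nonzero \<open>e\<close> so far right in its row that it leaves the greedy region.\<close>

lemma axioms_imp_row_recursion:
  assumes pos: "b > 0" "c > 0" and im: "(a1, a2) \<in> pos_imaginary_roots b c"
    and supp: "\<And>p q. e p q \<noteq> 0 \<Longrightarrow> in_greedy_region b c a1 a2 p q"
    and dvd: "\<And>q. dvd_gen_poly (divisor_poly b (a2 - int c * int q)) (\<lambda>i. e i q)"
  shows "row_recursion b c a1 a2 e"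
  unfolding row_recursion_def
proof (intro allI impI, rule ccontr)
  fix k q assume kq: "(k, q) \<noteq> (0::nat, 0::nat)" "int c * a1 * int q \<le> int b * a2 * int k"
    and nz: "row_quotient b (a2 - int c * int q) (\<lambda>i. e i q) $ k \<noteq> 0"
  define n where "n = a2 - int c * int q"
  obtain m where m: "m \<ge> k" "e (m + nat n) q \<noteq> 0"
    using quotient_nonzero_imp_row_nonzero[OF dvd nz] unfolding n_def by metis
  define p where "p = int m + max n 0"
  \<comment> \<open>The imaginary root inequality, solved for the form used in the first case below;
    it also yields \<open>c a1 > a2\<close>.\<close>
  have a: "a1 > 0" "a2 > 0" and im': "int c * a1 * a1 \<le> int b * a2 * (int c * a1 - a2)"
    using im by (auto simp: pos_imaginary_roots_def power2_eq_square algebra_simps)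
  have "int b * a2 * (int c * a1 - a2) > 0"
    using im' a pos by (smt (verit) mult_pos_pos of_nat_0_less_iff)
  then have d: "int c * a1 - a2 > 0"
    using zero_less_mult_pos a pos by fastforce
  have "int b * a2 * int k \<le> int b * a2 * int m"
    using m a by (intro mult_left_mono) auto
  then have kq': "int c * a1 * int q \<le> int b * a2 * int m"
    using kq by linarith
  then have le: "int c * a1 * int q + int b * a2 * max n 0 \<le> int b * a2 * p"
    by (simp add: p_def algebra_simps)
  have "int (m + nat n) = p"
    by (simp add: p_def)
  moreover have "in_greedy_region b c a1 a2 (m + nat n) q"
    by (rule supp[OF m(2)])
  ultimately consider
      "int c * a1 * int q + int b * (int c * a1 - a2) * p < int c * a1 * a1"
    | "int b * a2 * p + int c * (int b * a2 - a1) * int q < int b * a2 * a2"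
    | "m + nat n = 0" "int q = a1" | "p = a2" "q = 0"
    unfolding in_greedy_region_def by metis
  then show False
  proof cases
    case 1
    \<comment> \<open>Scaling the region inequality by \<open>a2\<close> produces
      \<open>b a2 p\<close>, which \<open>le\<close> bounds from below. For \<open>n > 0\<close> the
      rest is \<open>im'\<close> times \<open>n\<close>; otherwise \<open>c q\<close> is at least
      \<open>a2\<close>.\<close>
    have "a2 * (int c * a1 * a1) \<le> a2 * (int c * a1 * int q) +
        (int c * a1 - a2) * (int c * a1 * int q + int b * a2 * max n 0)"
    proof (cases "n > 0")
      case True
      have "n * (int c * a1 * a1) \<le> n * (int b * a2 * (int c * a1 - a2))"
        using True im' by (intro mult_left_mono) auto
      then show ?thesis
        using True by (simp add: n_def max_def algebra_simps)
    next
      case False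
      have "int c * a1 * a1 * a2 \<le> int c * a1 * a1 * (int c * int q)"
        using False a by (intro mult_left_mono) (auto simp: n_def)
      then show ?thesis
        using False by (simp add: max_def algebra_simps)
    qed
    also have "\<dots> \<le> a2 * (int c * a1 * int q) + (int c * a1 - a2) * (int b * a2 * p)"
      using le d by (intro add_left_mono mult_left_mono) auto
    also have "\<dots> = a2 * (int c * a1 * int q + int b * (int c * a1 - a2) * p)"
      by (simp add: algebra_simps)
    finally show False
      using 1 a by simp
  next
    case 2
    have "int b * a2 * n \<le> int b * a2 * max n 0"
      using a by (intro mult_left_mono) auto
    then show False
      using 2 le by (simp add: n_def algebra_simps)
  next
    case 3
    then have "a1 \<le> 0 \<or> int c \<le> 0"
      using kq' a by (auto simp: mult_le_0_iff zero_less_mult_iff)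
    then show False
      using a pos by auto
  next
    case 4
    \<comment> \<open>Here \<open>n = a2\<close>, so \<open>m = 0\<close> and \<open>(k, q)\<close>
      is the excluded origin.\<close>
    then show False
      using kq m a by (auto simp: p_def n_def)
  qed
qed

text \<open>Induction on \<open>p + q\<close>: away from the origin at least one of the two clauses
  applies, and it refers only to smaller sums.\<close>

lemma greedy_recursion_unique:
  assumes "greedy_recursion b c a1 a2 e" "greedy_recursion b c a1 a2 e'" "e 0 0 = e' 0 0"
  shows "e = e'"
proof -
  have "e p q = e' p q" for p q
  proof (induction "p + q" arbitrary: p q rule: less_induct)
    case less
    show ?case
    proof (cases "(p, q) = (0, 0)")
      case True
      then show ?thesis
        using assms by simp
    next
      case False
      have 1: "e (p - k) q = e' (p - k) q" if "k \<in> {1..p}" for k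
        using that by (intro less) auto
      have 2: "e p (q - k) = e' p (q - k)" if "k \<in> {1..q}" for k
        using that by (intro less) auto
      let ?r = "\<lambda>e. (\<Sum>k=1..p. (- 1) ^ (k - 1) * to_frac (e (p - k) q) *
        qbinom (to_frac (vpow (int b))) (pos_part (a2 - int c * int q) + int k - 1) k)"
      let ?c = "\<lambda>e. (\<Sum>l=1..q. (- 1) ^ (l - 1) * to_frac (e p (q - l)) *
        qbinom (to_frac (vpow (int c))) (pos_part (a1 - int b * int p) + int l - 1) l)"
      have r: "?r e = ?r e'"
        by (rule sum.cong) (simp_all only: 1)
      have c: "?c e = ?c e'"
        by (rule sum.cong) (simp_all only: 2)
      have rec_r: "to_frac (f p q) = ?r f" if "greedy_recursion b c a1 a2 f"
          "int c * a1 * int q \<le> int b * a2 * int p" for f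
        using that False unfolding greedy_recursion_def by blast
      have rec_c: "to_frac (f p q) = ?c f" if "greedy_recursion b c a1 a2 f"
          "int c * a1 * int q \<ge> int b * a2 * int p" for f
        using that False unfolding greedy_recursion_def by blast
      have "to_frac (e p q) = to_frac (e' p q)"
      proof (cases "int c * a1 * int q \<le> int b * a2 * int p")
        case True
        show ?thesis
          unfolding rec_r[OF assms(1) True] rec_r[OF assms(2) True] by (rule r)
      next
        case False
        then have le: "int c * a1 * int q \<ge> int b * a2 * int p"
          by simp
        show ?thesis
          unfolding rec_c[OF assms(1) le] rec_c[OF assms(2) le] by (rule c)
      qed
      then show ?thesis
        by (simp add: to_frac_eq_iff)
    qed
  qed
  then show ?thesis
    by blast
qed


section \<open>Uniqueness of pointed expansions\<close>

text \<open>\<open>X_monomial i j\<close> carries the factor \<open>v^(i j)\<close>, hence the shift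
  of the exponent of \<open>v\<close>.\<close>

lemma lookup_scalar_X_monomial:
  "Poly_Mapping.lookup (qtorus_scalar f * X_monomial i j) (QMon k i' j') =
    (if i' = i \<and> j' = j then Poly_Mapping.lookup f (k - i * j) else 0)"
proof -
  have "qtorus_scalar f * X_monomial i j =
      (\<Sum>m\<in>Poly_Mapping.keys f. Poly_Mapping.single (QMon (m + i * j) i j) (Poly_Mapping.lookup f m))"
    by (simp add: qtorus_scalar_def X_monomial_single sum_distrib_right mult_single)
  then have "Poly_Mapping.lookup (qtorus_scalar f * X_monomial i j) (QMon k i' j') =
      (\<Sum>m\<in>Poly_Mapping.keys f. if m = k - i * j \<and> i' = i \<and> j' = j then Poly_Mapping.lookup f m else 0)"
    by (auto simp: lookup_sum lookup_single when_def intro!: sum.cong)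
  then show ?thesis
    by (auto simp: in_keys_iff)
qed

text \<open>As \<open>b\<close> and \<open>c\<close> are positive, distinct \<open>(p, q)\<close>
  give distinct exponents, so each coefficient can be read off from the element of the
  torus.\<close>

lemma has_expansion_unique:
  assumes "b > 0" "c > 0" "inj \<iota>"
    and "has_expansion \<iota> b c a1 a2 X e" "has_expansion \<iota> b c a1 a2 X e'"
  shows "e = e'"
proof -
  define S where "S e = (\<Sum>(p, q)\<in>{(p, q). e p q \<noteq> 0}.
      qtorus_scalar (e p q) * X_monomial (int b * int p - a1) (int c * int q - a2))"
    for e :: "nat \<Rightarrow> nat \<Rightarrow> laurent"
  have lookup_S: "Poly_Mapping.lookup (e p q) k =
      Poly_Mapping.lookup (S e) (QMon (k + (int b * int p - a1) * (int c * int q - a2))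
        (int b * int p - a1) (int c * int q - a2))"
    if fin: "finite {(p, q). e p q \<noteq> 0}" for e p q k
  proof -
    have "Poly_Mapping.lookup (S e) (QMon (k + (int b * int p - a1) * (int c * int q - a2))
        (int b * int p - a1) (int c * int q - a2)) =
      (\<Sum>x\<in>{(p, q). e p q \<noteq> 0}. if x = (p, q) then Poly_Mapping.lookup (e p q) k else 0)"
      unfolding S_def lookup_sum
      by (rule sum.cong) (use assms(1,2) in \<open>auto simp: lookup_scalar_X_monomial split: if_splits\<close>)
    then show ?thesis
      using fin by auto
  qed
  have "\<iota> (S e) = \<iota> (S e')"
    using assms(4,5) by (simp add: has_expansion_def S_def)
  then have "S e = S e'"
    using assms(3) by (simp add: inj_eq)
  then have "Poly_Mapping.lookup (e p q) k = Poly_Mapping.lookup (e' p q) k" for p q k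
    using assms(4,5) by (simp add: has_expansion_def lookup_S)
  then show ?thesis
    by (intro ext poly_mapping_eqI)
qed

section \<open>Characterization of the greedy coefficients by support and divisibility\<close>

theorem theorem8:
  fixes b c :: nat and a1 a2 :: int
    and \<iota> :: "qtorus \<Rightarrow> 'f::division_ring"
    and X :: 'f and e :: "nat \<Rightarrow> nat \<Rightarrow> laurent"
  assumes "b > 0" and "c > 0"
    and "(a1, a2) \<in> pos_imaginary_roots b c"
    and "skew_field_of_fractions \<iota>"
    and "quantum_greedy \<iota> b c a1 a2 X"
    and "has_expansion \<iota> b c a1 a2 X e"
  shows "(e 0 0 = 1 \<and> support_axiom b c a1 a2 e \<and> divisibility_axiom b c a1 a2 e) \<and>
    (\<forall>e' :: nat \<Rightarrow> nat \<Rightarrow> laurent.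
      e' 0 0 = 1 \<and> support_axiom b c a1 a2 e' \<and> divisibility_axiom b c a1 a2 e' \<longrightarrow> e' = e)"
proof -
  have a: "a1 > 0" "a2 > 0"
    using assms(3) by (auto simp: pos_imaginary_roots_def)
  have im_swap: "(a2, a1) \<in> pos_imaginary_roots c b"
    using assms(3) by (auto simp: pos_imaginary_roots_def algebra_simps)
  have supp_iff: "support_axiom b c a1 a2 f \<longleftrightarrow> (\<forall>p q. f p q \<noteq> 0 \<longrightarrow> in_greedy_region b c a1 a2 p q)"
    for f
    unfolding support_axiom_def using R_greedy_iff[OF assms(1,2) a] by blast
  obtain e0 where e0: "has_expansion \<iota> b c a1 a2 X e0" "e0 0 0 = 1" "greedy_recursion b c a1 a2 e0"
    using assms(5) by (auto simp: quantum_greedy_def pointed_with_def)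
  have "e0 = e"
    using has_expansion_unique[OF assms(1,2) skew_field_of_fractions.inj[OF assms(4)] e0(1) assms(6)] .
  with e0 have e00: "e 0 0 = 1" and greedy: "greedy_recursion b c a1 a2 e"
    by auto
  have row: "row_recursion b c a1 a2 e" and col: "row_recursion c b a2 a1 (\<lambda>q p. e p q)"
    using greedy greedy_recursion_iff[OF assms(1,2)] by auto
  \<comment> \<open>The exceptional alternatives for row and column are opposite strict
    inequalities, so one of the two places \<open>(p, q)\<close> in the region.\<close>
  have "in_greedy_region b c a1 a2 p q" if "e p q \<noteq> 0" for p q
    using row_recursion_imp_region[OF assms(1) a row that]
      row_recursion_imp_region[OF assms(2) a(2,1) col, where p = q and q = p] that
    by (auto simp: in_greedy_region_swap)
  then have "support_axiom b c a1 a2 e"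
    by (simp add: supp_iff)
  moreover have "divisibility_axiom b c a1 a2 e"
    using row_recursion_imp_divisible[OF assms(1) a row]
      row_recursion_imp_divisible[OF assms(2) a(2,1) col]
    by (simp add: divisibility_axiom_def)
  moreover have "e' = e"
    if e': "e' 0 0 = 1" "support_axiom b c a1 a2 e'" "divisibility_axiom b c a1 a2 e'" for e'
  \<comment> \<open>The axioms for \<open>e'\<close> give back both halves of the recursion, which
    has only one solution with this value at the origin.\<close>
  proof (rule greedy_recursion_unique[OF _ greedy])
    have "row_recursion b c a1 a2 e'"
      using e' by (intro axioms_imp_row_recursion[OF assms(1-3)])
        (auto simp: supp_iff divisibility_axiom_def)
    moreover have "row_recursion c b a2 a1 (\<lambda>q p. e' p q)"
      using e' by (intro axioms_imp_row_recursion[OF assms(2,1) im_swap])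
        (auto simp: supp_iff divisibility_axiom_def in_greedy_region_swap)
    ultimately show "greedy_recursion b c a1 a2 e'"
      using greedy_recursion_iff[OF assms(1,2)] by auto
    show "e' 0 0 = e 0 0"
      using e' e00 by simp
  qed
  ultimately show ?thesis
    using e00 by blast
qed

end
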